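(* Let $\epsilon=o(W^{-1})$, and denote $\mathcal B=W\log\left\lfloor\frac{1}{4W\epsilon}+1\right\rfloor$. Then Algorithm 3 (described in the context, run with $\upsilon=\lceil\log(\epsilon^{-1}W)\rceil$ and $k=\left\lceil\frac1{2\epsilon-2^{-\upsilon}}\right\rceil$) provides an $RW\epsilon$-additive approximation to Basic-Summing (with window size $W$ and integer elements in $\{0,1,\dots,R\}$) using $\mathcal B\cdot(1+o(1))$ bits of memory.
   Context: All logarithms are base 2; $W,R\ge1$ are integers, $\epsilon>0$ depends on $W$, and the $o(\cdot)$ notation is for $W\to\infty$. Basic-Summing: given a stream of integers in $\{0,1,\dots,R\}$ arriving one at a time, maintain the sum $S$ of the last $W$ elements (elements before the beginning of the stream are regarded as 0). An $RW\epsilon$-additive approximation means that for every input stream and at every time the value $\widehat S$ returned by Query satisfies $|\widehat S-S|\le RW\epsilon$. The memory of the algorithm is the number of bits used to store its variables. For $z\in[0,1]$, $\mathrm{Round}_{\upsilon}(z)$ denotes rounding of $z$ to the nearest value $\widetilde z$ such that $2^{\upsilon}\widetilde z$ is an integer. Algorithm 3. Variables: a fractional number $y$, integers $B,i$, and an array $b=(b_0,\dots,b_{W-1})$ of nonnegative integers, all initialized to $0$. Add(element $x$): do in order: (1) $x'=\mathrm{Round}_{\upsilon}\left(\frac xR\right)$; (2) $B\leftarrow B-b_i$; (3) $b_i\leftarrow\left\lfloor\frac{y+x'}{W/k}\right\rfloor$; (4) $y\leftarrow y+x'-b_i\cdot\frac Wk$; (5) $B\leftarrow B+b_i$; (6)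 $i\leftarrow i+1\bmod W$. Query: return $R\cdot\left(\frac Wk\cdot B+y-\frac W{2k}\right)$. Each arriving stream element is processed by one call of Add. Each cell of $b$ needs to represent a value in $\{0,1,\dots,\lfloor1+\frac kW\rfloor\}$; the remainder $y$ is a fractional number represented using $\upsilon$ bits; $i$ and $B$ are stored as binary integers. *)

theory Defs
  imports "HOL-Analysis.Analysis" "HOL-Library.Landau_Symbols"
begin

text \<open>The prefixes of all streams are exactly the finite lists over \<open>{0..R}\<close>, so quantifying over these
  lists covers every stream at every time. Elements before the beginning of the stream count as 0,
  which is why a list shorter than \<open>W\<close> is simply summed up.\<close>

definition window_sum :: "nat \<Rightarrow> nat list \<Rightarrow> nat" where
  "window_sum W xs = sum_list (take W (rev xs))"

definition streams_upto :: "nat \<Rightarrow> nat list set" where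
  "streams_upto R = {xs. set xs \<subseteq> {0..R}}"

definition additive_approx_summing ::
    "nat \<Rightarrow> nat \<Rightarrow> real \<Rightarrow> 's \<Rightarrow> ('s \<Rightarrow> nat \<Rightarrow> 's) \<Rightarrow> ('s \<Rightarrow> real) \<Rightarrow> bool" where
  "additive_approx_summing W R \<Delta> init add query \<longleftrightarrow>
     (\<forall>xs\<in>streams_upto R. \<bar>query (foldl add init xs) - real (window_sum W xs)\<bar> \<le> \<Delta>)"

text \<open>Ties are rounded upwards, as in the library function \<^const>\<open>round\<close>.\<close>

definition Round :: "int \<Rightarrow> real \<Rightarrow> real" where
  "Round \<upsilon> z = real_of_int (round (2 powi \<upsilon> * z)) / 2 powi \<upsilon>"

record alg3_state =
  y_var :: real
  B_var :: int
  i_var :: nat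
  b_var :: "int list"

definition alg3_init :: "nat \<Rightarrow> alg3_state" where
  "alg3_init W = \<lparr>y_var = 0, B_var = 0, i_var = 0, b_var = replicate W 0\<rparr>"

definition alg3_add :: "nat \<Rightarrow> nat \<Rightarrow> int \<Rightarrow> int \<Rightarrow> alg3_state \<Rightarrow> nat \<Rightarrow> alg3_state" where
  "alg3_add W R \<upsilon> k s x =
    (let i = i_var s;
         x' = Round \<upsilon> (real x / real R);
         B1 = B_var s - b_var s ! i;
         bi = \<lfloor>(y_var s + x') / (real W / real_of_int k)\<rfloor>;
         y = y_var s + x' - real_of_int bi * (real W / real_of_int k);
         B2 = B1 + bi
     in \<lparr>y_var = y, B_var = B2, i_var = (i + 1) mod W, b_var = (b_var s)[i := bi]\<rparr>)"

definition alg3_query :: "nat \<Rightarrow> nat \<Rightarrow> int \<Rightarrow> alg3_state \<Rightarrow> real" where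
  "alg3_query W R k s =
     real R * (real W / real_of_int k * real_of_int (B_var s) + y_var s
               - real W / (2 * real_of_int k))"

definition alg3_reachable :: "nat \<Rightarrow> nat \<Rightarrow> int \<Rightarrow> int \<Rightarrow> alg3_state set" where
  "alg3_reachable W R \<upsilon> k = foldl (alg3_add W R \<upsilon> k) (alg3_init W) ` streams_upto R"

definition alg3_upsilon :: "nat \<Rightarrow> real \<Rightarrow> int" where
  "alg3_upsilon W e = \<lceil>log 2 (real W / e)\<rceil>"

definition alg3_k :: "nat \<Rightarrow> real \<Rightarrow> int" where
  "alg3_k W e = \<lceil>1 / (2 * e - 2 powi (- alg3_upsilon W e))\<rceil>"

definition bits_for :: "nat \<Rightarrow> nat" where
  "bits_for n = nat \<lceil>log 2 (real n)\<rceil>"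

definition cell_range :: "nat \<Rightarrow> int \<Rightarrow> int set" where
  "cell_range W k = {0..\<lfloor>1 + real_of_int k / real W\<rfloor>}"

definition index_range :: "nat \<Rightarrow> nat set" where
  "index_range W = {0..<W}"

definition B_range :: "nat \<Rightarrow> int \<Rightarrow> int set" where
  "B_range W k = {0..int W * \<lfloor>1 + real_of_int k / real W\<rfloor>}"

text \<open>The remainder satisfies \<open>0 \<le> y < W / k\<close>. As \<open>W / k\<close> need not be a multiple of
  \<open>2 powi - \<upsilon>\<close>, neither need \<open>y\<close>, but \<open>y\<close> is always a multiple of \<open>2 powi - \<upsilon> / k\<close>; this
  leaves up to \<open>W * 2 powi \<upsilon>\<close> values.\<close>

definition y_range :: "nat \<Rightarrow> int \<Rightarrow> int \<Rightarrow> real set" where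
  "y_range W \<upsilon> k =
     {real_of_int j / (real_of_int k * 2 powi \<upsilon>) | j :: int.
        0 \<le> j \<and> real_of_int j < real W * 2 powi \<upsilon>}"

definition alg3_state_range :: "nat \<Rightarrow> int \<Rightarrow> int \<Rightarrow> alg3_state set" where
  "alg3_state_range W \<upsilon> k =
     {s. y_var s \<in> y_range W \<upsilon> k \<and> B_var s \<in> B_range W k \<and> i_var s \<in> index_range W \<and>
         length (b_var s) = W \<and> set (b_var s) \<subseteq> cell_range W k}"

text \<open>The total size of all variables when \<open>q\<close> bits are allocated to \<open>y\<close>. The accounting with
  \<open>\<upsilon>\<close> fractional bits is \<open>q = \<upsilon>\<close>; to hold every element of \<^const>\<open>y_range\<close> without any
  further rounding one needs \<open>q = bits_for (card (y_range W \<upsilon> k))\<close>.\<close>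

definition alg3_memory :: "nat \<Rightarrow> nat \<Rightarrow> int \<Rightarrow> nat" where
  "alg3_memory q W k =
     q + bits_for (card (B_range W k)) + bits_for (card (index_range W))
       + W * bits_for (card (cell_range W k))"

definition summing_budget :: "nat \<Rightarrow> real \<Rightarrow> real" where
  "summing_budget W e = real W * log 2 (real_of_int \<lfloor>1 / (4 * real W * e) + 1\<rfloor>)"

end

theory Submission
  imports Defs
begin

text \<open>Each step satisfies \<open>y + x' = y' + b\<^sub>i W / k\<close>, so the rounded window sum telescopes to \<open>B W / k\<close>
  plus the difference of two values of \<open>y\<close>. The query keeps the newer one and replaces the older one,
  which lies in \<open>[0, W / k)\<close>, by its midpoint; the total error is at most
  \<open>R W (2 powi - \<upsilon> + 1 / k) / 2\<close>, and \<open>k\<close> is chosen to make this at most \<open>R W \<epsilon>\<close>. For the memory put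
  \<open>N = 1 / (4 W \<epsilon>)\<close>, which tends to infinity. As \<open>2 N \<le> k / W \<le> 4 N + 1\<close>, each cell takes
  \<open>log N + O(1)\<close> bits, while the other variables take \<open>O(log W + log N)\<close> bits in total.\<close>

section \<open>State invariant and the circular buffer\<close>

text \<open>The part of the invariant that an update preserves for any element and any \<upsilon>;
  the ranges relying on \<open>x \<le> R\<close> and \<open>\<upsilon> \<ge> 0\<close> are built on
  top of it later.\<close>

definition consistent :: "nat \<Rightarrow> int \<Rightarrow> alg3_state \<Rightarrow> bool" where
  "consistent W k s \<longleftrightarrow> length (b_var s) = W \<and> i_var s < W \<and> B_var s = sum_list (b_var s) \<and>
     0 \<le> y_var s \<and> y_var s < real W / real_of_int k"

text \<open>Newest cell first: \<open>i_var s\<close> points at the oldest cell, the next to be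
  overwritten, so the array is read backwards from the slot before it, wrapping around.\<close>

definition recent_cells :: "alg3_state \<Rightarrow> int list" where
  "recent_cells s = rev (take (i_var s) (b_var s)) @ rev (drop (i_var s) (b_var s))"

lemma foldl_invariant:
  assumes "P a" "\<And>s x. P s \<Longrightarrow> x \<in> set xs \<Longrightarrow> P (f s x)"
  shows "P (foldl f a xs)"
  using assms by (induction xs arbitrary: a) auto

lemma sum_list_update_int:
  "i < length b \<Longrightarrow> sum_list (b[i := v]) = sum_list b - b ! i + (v :: int)"
  by (induction b arbitrary: i) (auto split: nat.splits simp: nth_Cons)

lemma consistent_init: "W \<ge> 1 \<Longrightarrow> k \<ge> 1 \<Longrightarrow> consistent W k (alg3_init W)"
  by (auto simp: consistent_def alg3_init_def sum_list_replicate)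

lemma floor_remainder:
  fixes a c :: real
  assumes "c > 0"
  shows "0 \<le> a - real_of_int \<lfloor>a / c\<rfloor> * c" "a - real_of_int \<lfloor>a / c\<rfloor> * c < c"
proof -
  have "real_of_int \<lfloor>a / c\<rfloor> * c \<le> a / c * c" "a / c * c < (real_of_int \<lfloor>a / c\<rfloor> + 1) * c"
    using assms by (intro mult_right_mono mult_strict_right_mono; linarith)+
  then show "0 \<le> a - real_of_int \<lfloor>a / c\<rfloor> * c" "a - real_of_int \<lfloor>a / c\<rfloor> * c < c"
    using assms by (auto simp: algebra_simps)
qed

lemma consistent_add:
  assumes "W \<ge> 1" "k \<ge> 1" "consistent W k s"
  shows "consistent W k (alg3_add W R \<upsilon> k s x)"
  using assms floor_remainder[of "real W / real_of_int k" "y_var s + Round \<upsilon> (real x / real R)"]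
  by (auto simp: consistent_def alg3_add_def Let_def sum_list_update_int)

lemma sum_recent_cells: "sum_list (recent_cells s) = sum_list (b_var s)"
proof -
  have "sum_list (b_var s) = sum_list (take (i_var s) (b_var s) @ drop (i_var s) (b_var s))"
    by simp
  then show ?thesis
    by (simp add: recent_cells_def del: append_take_drop_id)
qed

lemma length_recent_cells: "length (recent_cells s) = length (b_var s)"
  by (simp add: recent_cells_def)

text \<open>In order of age the oldest cell stands last, so overwriting it drops the last entry and
  puts the new value in front.\<close>

lemma recent_cells_overwrite:
  assumes "i < length b"
  shows "recent_cells \<lparr>y_var = y', B_var = B', i_var = (i + 1) mod length b, b_var = b[i := v]\<rparr>
       = v # butlast (rev (take i b) @ rev (drop i b))"
proof -
  have drop_i: "drop i b = b ! i # drop (Suc i) b"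
    using assms by (simp add: Cons_nth_drop_Suc)
  have take_Suc: "take (Suc i) (b[i := v]) = take i b @ [v]"
    using assms by (simp add: take_Suc_conv_app_nth)
  show ?thesis
  proof (cases "Suc i = length b")
    \<comment> \<open>The index wraps to \<open>0\<close>, so the whole array moves into the
      \<open>drop\<close> part of \<open>recent_cells\<close>.\<close>
    case True
    then have "b[i := v] = take i b @ [v]"
      using take_Suc by simp
    with True show ?thesis
      using assms by (simp add: recent_cells_def drop_i butlast_append)
  next
    case False
    with assms have "Suc i < length b" by simp
    then show ?thesis
      using take_Suc by (simp add: recent_cells_def drop_i butlast_append)
  qed
qed

text \<open>The telescoped update \<open>y + x' = y' + b\<^sub>i W / k\<close> over the last \<open>n\<close> steps; the witness \<open>z\<close> is the
  value of \<open>y\<close> from \<open>n\<close> steps ago, or \<open>0\<close> if the stream is shorter.\<close>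

lemma telescoped_remainder:
  fixes W R n :: nat and \<upsilon> k :: int
  assumes "W \<ge> 1" "k \<ge> 1" "n \<le> W"
  defines "s \<equiv> \<lambda>xs. foldl (alg3_add W R \<upsilon> k) (alg3_init W) xs"
  shows "\<exists>z. 0 \<le> z \<and> z < real W / real_of_int k \<and>
     y_var (s xs) + real W / real_of_int k * real_of_int (sum_list (take n (recent_cells (s xs))))
      = (\<Sum>x\<leftarrow>take n (rev xs). Round \<upsilon> (real x / real R)) + z"
  using \<open>n \<le> W\<close>
proof (induction xs arbitrary: n rule: rev_induct)
  case Nil
  then show ?case
    using assms(1,2)
    by (auto simp: s_def alg3_init_def recent_cells_def sum_list_replicate)
next
  case (snoc x xs)
  have cons: "consistent W k (s ys)" for ys
    unfolding s_def
    by (rule foldl_invariant) (use assms in \<open>auto intro: consistent_init consistent_add\<close>)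
  have step: "s (xs @ [x]) = alg3_add W R \<upsilon> k (s xs) x"
    by (simp add: s_def)
  show ?case
  proof (cases n)
    case 0
    \<comment> \<open>Zero steps back, the witness is the current remainder.\<close>
    then show ?thesis using cons[of "xs @ [x]"] by (auto simp: consistent_def)
  next
    case (Suc m)
    define v where "v = \<lfloor>(y_var (s xs) + Round \<upsilon> (real x / real R)) / (real W / real_of_int k)\<rfloor>"
    have len: "length (b_var (s xs)) = W" and i: "i_var (s xs) < W"
      using cons[of xs] by (auto simp: consistent_def)
    have "recent_cells (s (xs @ [x])) = v # butlast (recent_cells (s xs))"
      using recent_cells_overwrite[of "i_var (s xs)" "b_var (s xs)"] len i
      by (simp add: step alg3_add_def Let_def v_def recent_cells_def[of "s xs"])
    \<comment> \<open>The entry lost to \<open>butlast\<close> is not among the first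
      \<open>m\<close>, because \<open>m < n \<le> W\<close>.\<close>
    moreover have "take m (butlast (recent_cells (s xs))) = take m (recent_cells (s xs))"
      using Suc snoc.prems len by (simp add: take_butlast length_recent_cells)
    ultimately have cells: "take n (recent_cells (s (xs @ [x]))) = v # take m (recent_cells (s xs))"
      using Suc by simp
    have y: "y_var (s (xs @ [x])) = y_var (s xs) + Round \<upsilon> (real x / real R) - real_of_int v * (real W / real_of_int k)"
      by (simp add: step alg3_add_def Let_def v_def)
    obtain z where z: "0 \<le> z" "z < real W / real_of_int k"
      "y_var (s xs) + real W / real_of_int k * real_of_int (sum_list (take m (recent_cells (s xs))))
        = (\<Sum>x\<leftarrow>take m (rev xs). Round \<upsilon> (real x / real R)) + z"
      using snoc.IH[of m] snoc.prems Suc by auto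
    \<comment> \<open>The witness carries over: \<open>n\<close> steps back from the new state is
      \<open>m\<close> steps back from the old one.\<close>
    show ?thesis
      using z by (intro exI[of _ z]) (simp add: cells[unfolded Suc] y Suc algebra_simps)
  qed
qed

section \<open>Rounding error and error of the query\<close>

lemma Round_error: "\<bar>Round \<upsilon> z - z\<bar> \<le> 2 powi (- \<upsilon>) / 2"
proof -
  have p: "(2 :: real) powi \<upsilon> > 0" by simp
  have "\<bar>real_of_int (round (2 powi \<upsilon> * z)) - 2 powi \<upsilon> * z\<bar> \<le> 1 / 2"
    by (rule of_int_round_abs_le)
  then have "\<bar>real_of_int (round (2 powi \<upsilon> * z)) - 2 powi \<upsilon> * z\<bar> / 2 powi \<upsilon> \<le> 1 / 2 / 2 powi \<upsilon>"
    by (intro divide_right_mono) auto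
  moreover have "\<bar>real_of_int (round (2 powi \<upsilon> * z)) - 2 powi \<upsilon> * z\<bar> / 2 powi \<upsilon> = \<bar>Round \<upsilon> z - z\<bar>"
    using p by (simp add: Round_def divide_simps abs_if) (simp add: algebra_simps)
  ultimately show ?thesis
    by (simp add: power_int_minus field_simps)
qed

lemma sum_list_abs_diff_le:
  fixes f g :: "'a \<Rightarrow> real"
  assumes "\<And>x. x \<in> set xs \<Longrightarrow> \<bar>f x - g x\<bar> \<le> c"
  shows "\<bar>(\<Sum>x\<leftarrow>xs. f x) - (\<Sum>x\<leftarrow>xs. g x)\<bar> \<le> real (length xs) * c"
  using assms
proof (induction xs)
  case (Cons x xs)
  have "\<bar>f x - g x\<bar> \<le> c" and "\<bar>(\<Sum>x\<leftarrow>xs. f x) - (\<Sum>x\<leftarrow>xs. g x)\<bar> \<le> real (length xs) * c"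
    using Cons by auto
  then show ?case by (simp add: algebra_simps)
qed simp

text \<open>Two errors add up: at most \<open>W\<close> roundings, each off by at most
  \<open>2 powi (- \<upsilon>) / 2\<close>, and the midpoint that replaces the older remainder, off
  by at most half of \<open>W / k\<close>.\<close>

lemma alg3_error:
  assumes "W \<ge> 1" "R \<ge> 1" "k \<ge> 1"
  shows "\<bar>alg3_query W R k (foldl (alg3_add W R \<upsilon> k) (alg3_init W) xs) - real (window_sum W xs)\<bar>
           \<le> real R * (real W / 2 * (2 powi (- \<upsilon>) + 1 / real_of_int k))"
proof -
  define s where "s = foldl (alg3_add W R \<upsilon> k) (alg3_init W) xs"
  have cons: "consistent W k s"
    unfolding s_def
    by (rule foldl_invariant) (use assms in \<open>auto intro: consistent_init consistent_add\<close>)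
  define ws where "ws = take W (rev xs)"
  define T where "T = (\<Sum>x\<leftarrow>ws. Round \<upsilon> (real x / real R))"
  \<comment> \<open>With \<open>n = W\<close> the telescoped sum covers the entire array, whose sum
    is \<open>B_var s\<close>.\<close>
  have "take W (recent_cells s) = recent_cells s"
    using cons by (simp add: length_recent_cells consistent_def)
  then obtain z where z: "0 \<le> z" "z < real W / real_of_int k"
    "y_var s + real W / real_of_int k * real_of_int (B_var s) = T + z"
    using telescoped_remainder[of W k W R \<upsilon> xs] assms cons
    by (auto simp: s_def sum_recent_cells consistent_def T_def ws_def)
  have "\<bar>T - (\<Sum>x\<leftarrow>ws. real x / real R)\<bar> \<le> real (length ws) * (2 powi (- \<upsilon>) / 2)"
    unfolding T_def by (rule sum_list_abs_diff_le) (rule Round_error)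
  \<comment> \<open>A stream shorter than \<open>W\<close> only incurs fewer roundings.\<close>
  also have "\<dots> \<le> real W * (2 powi (- \<upsilon>) / 2)"
    by (intro mult_right_mono) (auto simp: ws_def)
  finally have T: "\<bar>T - (\<Sum>x\<leftarrow>ws. real x / real R)\<bar> \<le> real W * (2 powi (- \<upsilon>) / 2)" .
  have "real (sum_list ws) = real R * (\<Sum>x\<leftarrow>ws. real x / real R)"
    using \<open>R \<ge> 1\<close> by (induction ws) (auto simp: field_simps)
  then have "alg3_query W R k s - real (window_sum W xs)
      = real R * ((T - (\<Sum>x\<leftarrow>ws. real x / real R)) + (z - real W / (2 * real_of_int k)))"
    using z(3) by (simp add: alg3_query_def window_sum_def ws_def algebra_simps)
  moreover have "\<bar>(T - (\<Sum>x\<leftarrow>ws. real x / real R)) + (z - real W / (2 * real_of_int k))\<bar>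
      \<le> real W * (2 powi (- \<upsilon>) / 2) + real W / real_of_int k / 2"
  proof -
    have "\<bar>a + (z - c / 2)\<bar> \<le> p + c / 2" if "\<bar>a\<bar> \<le> p" "z < c" for a c p :: real
      using that z(1) by linarith
    from this[OF T z(2)] show ?thesis by (simp add: mult.commute)
  qed
  ultimately have "\<bar>alg3_query W R k s - real (window_sum W xs)\<bar>
      \<le> real R * (real W * (2 powi (- \<upsilon>) / 2) + real W / real_of_int k / 2)"
    by (simp add: abs_mult mult_left_mono)
  then show ?thesis by (simp add: s_def algebra_simps)
qed

section \<open>Size of \<upsilon> and k\<close>

text \<open>Taking the ceiling of the logarithm costs at most a factor 2. The lower bound serves the
  accuracy, the upper one the count of remainders.\<close>

lemma upsilon_bounds:
  assumes "W \<ge> 1" "e > 0"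
  shows "real W / e \<le> 2 powi alg3_upsilon W e" "2 powi alg3_upsilon W e \<le> 2 * (real W / e)"
proof -
  define l where "l = log 2 (real W / e)"
  have l: "2 powr l = real W / e"
    using assms by (simp add: l_def)
  have p: "(2 :: real) powi alg3_upsilon W e = 2 powr real_of_int \<lceil>l\<rceil>"
    by (simp add: alg3_upsilon_def l_def powr_real_of_int')
  have "2 powr l \<le> 2 powr real_of_int \<lceil>l\<rceil>" "2 powr real_of_int \<lceil>l\<rceil> \<le> 2 powr (l + 1)"
    by (intro powr_mono; linarith)+
  then show "real W / e \<le> 2 powi alg3_upsilon W e" "2 powi alg3_upsilon W e \<le> 2 * (real W / e)"
    using l p by (auto simp: powr_add mult.commute)
qed

text \<open>Since \<open>2 powi (- \<upsilon>) \<le> e / W \<le> e\<close>, the denominator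
  \<open>r\<close> in the definition of k lies in \<open>[e, 2 * e]\<close>, and
  \<open>k \<ge> 1 / r\<close> gives \<open>1 / k \<le> r\<close>. The first bound is the accuracy
  condition; the next two control the memory.\<close>

lemma k_bounds:
  assumes "W \<ge> 1" "e > 0"
  shows "2 powi (- alg3_upsilon W e) + 1 / real_of_int (alg3_k W e) \<le> 2 * e"
    "1 / (2 * e) \<le> real_of_int (alg3_k W e)" "real_of_int (alg3_k W e) \<le> 1 / e + 1" "alg3_k W e \<ge> 1"
proof -
  define u where "u = (2 :: real) powi (- alg3_upsilon W e)"
  have u0: "u > 0" by (simp add: u_def)
  have "u = 1 / 2 powi alg3_upsilon W e"
    by (simp add: u_def power_int_minus field_simps)
  also have "\<dots> \<le> 1 / (real W / e)"
    using assms upsilon_bounds(1)[OF assms] by (intro divide_left_mono) auto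
  also have "\<dots> \<le> e" using assms by (simp add: field_simps)
  finally have u: "u \<le> e" .
  define r where "r = 2 * e - u"
  have r: "e \<le> r" "r \<le> 2 * e" "r > 0" using u u0 assms by (auto simp: r_def)
  have k: "alg3_k W e = \<lceil>1 / r\<rceil>" by (simp add: alg3_k_def r_def u_def)
  have kr: "1 / r \<le> real_of_int (alg3_k W e)" "real_of_int (alg3_k W e) \<le> 1 / r + 1"
    unfolding k by linarith+
  have "1 / (2 * e) \<le> 1 / r" "1 / r \<le> 1 / e"
    using r assms by (auto intro!: divide_left_mono)
  then show "1 / (2 * e) \<le> real_of_int (alg3_k W e)" "real_of_int (alg3_k W e) \<le> 1 / e + 1"
    using kr by auto
  have "1 / r > 0" using r by simp
  then show k1: "alg3_k W e \<ge> 1" using kr(1) by linarith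
  have "1 / real_of_int (alg3_k W e) \<le> r"
    using kr(1) k1 r(3) by (simp add: field_simps)
  then show "2 powi (- alg3_upsilon W e) + 1 / real_of_int (alg3_k W e) \<le> 2 * e"
    by (simp add: r_def u_def)
qed

section \<open>Reachable states stay in the allotted ranges\<close>

lemma state_range_init:
  assumes "W \<ge> 1" "k \<ge> 1"
  shows "alg3_init W \<in> alg3_state_range W \<upsilon> k"
proof -
  have "\<lfloor>1 + real_of_int k / real W\<rfloor> \<ge> 0"
    using assms by (simp add: add_nonneg_nonneg)
  then show ?thesis
    using assms
    by (auto simp: alg3_state_range_def alg3_init_def y_range_def B_range_def index_range_def
        cell_range_def intro!: exI[of _ 0])
qed

text \<open>For \<open>\<upsilon> \<ge> 0\<close> the value 1 is itself a rounded value, and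
  rounding is monotone.\<close>

lemma Round_le_1:
  assumes "\<upsilon> \<ge> 0" "z \<le> 1"
  shows "Round \<upsilon> z \<le> 1"
proof -
  have "round (2 powi \<upsilon> * z) \<le> round (real_of_int (2 ^ nat \<upsilon>))"
    using assms by (intro round_mono) (simp add: power_int_def)
  also have "\<dots> = 2 ^ nat \<upsilon>" by (rule round_of_int)
  finally have "real_of_int (round (2 powi \<upsilon> * z)) \<le> real_of_int (2 ^ nat \<upsilon>)"
    by (simp only: of_int_le_iff)
  then show ?thesis using assms by (simp add: Round_def power_int_def)
qed

lemma Round_nonneg: "z \<ge> 0 \<Longrightarrow> Round \<upsilon> z \<ge> 0"
  by (simp add: Round_def round_def)

lemma sum_list_int_le: "set b \<subseteq> {0..c} \<Longrightarrow> sum_list b \<in> {0..int (length b) * (c :: int)}"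
  by (induction b) (auto simp: algebra_simps)

text \<open>Since \<open>0 \<le> \<upsilon>\<close>, both \<open>x'\<close> and \<open>b\<^sub>i W / k\<close> are integer multiples of \<open>2 powi - \<upsilon> / k\<close>.\<close>

lemma state_range_add:
  assumes "W \<ge> 1" "k \<ge> 1" "\<upsilon> \<ge> 0" "x \<le> R" "R \<ge> 1"
    and cons: "consistent W k s" and s: "s \<in> alg3_state_range W \<upsilon> k"
  shows "alg3_add W R \<upsilon> k s x \<in> alg3_state_range W \<upsilon> k"
proof -
  define c where "c = real W / real_of_int k"
  define x' where "x' = Round \<upsilon> (real x / real R)"
  define v where "v = \<lfloor>(y_var s + x') / c\<rfloor>"
  define s' where "s' = alg3_add W R \<upsilon> k s x"
  have s'_eq: "y_var s' = y_var s + x' - real_of_int v * c" "i_var s' = (i_var s + 1) mod W"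
    "b_var s' = (b_var s)[i_var s := v]"
    by (simp_all add: s'_def alg3_add_def Let_def v_def c_def x'_def)
  have cons': "consistent W k s'"
    unfolding s'_def using assms by (intro consistent_add)
  have c: "c > 0" using assms by (simp add: c_def)
  have x': "0 \<le> x'" "x' \<le> 1"
    using assms by (auto simp: x'_def intro!: Round_nonneg Round_le_1)
  have y: "0 \<le> y_var s" "y_var s < c"
    using cons by (auto simp: consistent_def c_def)
  have v0: "v \<ge> 0" using x' y c by (simp add: v_def)
  \<comment> \<open>The upper end of \<open>cell_range\<close> is what \<open>y < c\<close> and
    \<open>x' \<le> 1\<close> yield for the new cell.\<close>
  have "(y_var s + x') / c \<le> (c + 1) / c"
    using x' y c by (intro divide_right_mono) auto
  also have "\<dots> = 1 + real_of_int k / real W"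
    using assms by (simp add: c_def field_simps)
  finally have v: "v \<in> cell_range W k"
    using v0 floor_mono unfolding v_def cell_range_def atLeastAtMost_iff by blast
  have cells: "set (b_var s') \<subseteq> cell_range W k" and len: "length (b_var s') = W"
    using s v set_update_subset_insert[of "b_var s" "i_var s" v]
    by (auto simp: s'_eq alg3_state_range_def)
  have B: "B_var s' \<in> B_range W k"
    using sum_list_int_le[OF cells[unfolded cell_range_def]] len cons'
    by (auto simp: B_range_def consistent_def)
  define P where "P = (2 :: int) ^ nat \<upsilon>"
  have P: "(2 :: real) powi \<upsilon> = real_of_int P" "P > 0"
    using \<open>\<upsilon> \<ge> 0\<close> by (auto simp: P_def power_int_def)
  obtain j where j: "y_var s = real_of_int j / (real_of_int k * real_of_int P)"
    using s by (auto simp: alg3_state_range_def y_range_def P)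
  define m where "m = round (2 powi \<upsilon> * (real x / real R))"
  have x'_eq: "x' = real_of_int m / real_of_int P"
    by (simp add: x'_def Round_def m_def P)
  \<comment> \<open>The numerator of the new remainder over \<open>k * P\<close>: the old one
    contributes \<open>j\<close>, the rounded element \<open>m * k\<close>, and the new cell removes
    \<open>v * W * P\<close>.\<close>
  define j' where "j' = j + m * k - v * int W * P"
  have "real_of_int P \<noteq> 0" "real_of_int k \<noteq> 0" using P(2) assms by auto
  then have "y_var s' = real_of_int j' / (real_of_int k * real_of_int P)"
    unfolding s'_eq j x'_eq j'_def c_def by (simp add: divide_simps)
  moreover from this have j'_eq: "real_of_int j' = y_var s' * real_of_int k * real_of_int P"
    using P(2) assms by simp
  have yk: "0 \<le> y_var s' * real_of_int k" "y_var s' * real_of_int k < real W"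
    using cons' assms by (auto simp: consistent_def field_simps)
  have "real_of_int j' \<ge> 0" "real_of_int j' < real W * real_of_int P"
    unfolding j'_eq using yk P(2) by (auto intro!: mult_strict_right_mono mult_nonneg_nonneg)
  ultimately have "y_var s' \<in> y_range W \<upsilon> k"
    by (auto simp: y_range_def P)
  then show ?thesis
    using cells len B cons' by (auto simp: alg3_state_range_def consistent_def index_range_def s'_def)
qed

lemma reachable_subset_state_range:
  assumes "W \<ge> 1" "k \<ge> 1" "\<upsilon> \<ge> 0" "R \<ge> 1"
  shows "alg3_reachable W R \<upsilon> k \<subseteq> alg3_state_range W \<upsilon> k"
proof -
  \<comment> \<open>The ranges alone are not inductive: bounding \<open>B_var\<close> requires it to
    equal the sum of the cells.\<close>
  define good where "good = (\<lambda>s. consistent W k s \<and> s \<in> alg3_state_range W \<upsilon> k)"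
  have "good (foldl (alg3_add W R \<upsilon> k) (alg3_init W) xs)" if "xs \<in> streams_upto R" for xs
  proof (rule foldl_invariant)
    show "good (alg3_init W)"
      using assms by (simp add: good_def consistent_init state_range_init)
    fix s x
    assume "good s" "x \<in> set xs"
    moreover from this have "x \<le> R" using that by (auto simp: streams_upto_def)
    ultimately show "good (alg3_add W R \<upsilon> k s x)"
      using assms by (simp add: good_def consistent_add state_range_add)
  qed
  then show ?thesis by (auto simp: alg3_reachable_def good_def)
qed

section \<open>Bit counts for a fixed window size\<close>

lemma bits_for_bounds:
  assumes "n \<ge> 1"
  shows "log 2 (real n) \<le> real (bits_for n)" "real (bits_for n) \<le> log 2 (real n) + 1"
proof -
  have "log 2 (real n) \<ge> 0" using assms by simp
  then have "real (bits_for n) = real_of_int \<lceil>log 2 (real n)\<rceil>"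
    unfolding bits_for_def by (intro of_nat_nat) linarith
  then show "log 2 (real n) \<le> real (bits_for n)" "real (bits_for n) \<le> log 2 (real n) + 1"
    by linarith+
qed

lemma bits_for_le:
  assumes "m \<ge> 1" "real n \<le> m"
  shows "real (bits_for n) \<le> log 2 m + 1"
proof (cases "n = 0")
  case True
  \<comment> \<open>By convention \<open>log 2 0 = 0\<close>, hence
    \<open>bits_for 0 = 0\<close>.\<close>
  then show ?thesis using assms by (simp add: bits_for_def log_def)
next
  case False
  then have "log 2 (real n) \<le> log 2 m" using assms by simp
  then show ?thesis using bits_for_bounds(2)[of n] False by linarith
qed

text \<open>The range is covered by the images of the integers below a ceiling, which accounts for
  the additive 1.\<close>

lemma card_y_range_le:
  "real (card (y_range W \<upsilon> k)) \<le> real W * 2 powi \<upsilon> + 1"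
proof -
  define m where "m = \<lceil>real W * 2 powi \<upsilon>\<rceil>"
  have "real W * 2 powi \<upsilon> \<ge> 0" by simp
  then have m: "m \<ge> 0" unfolding m_def by linarith
  have "y_range W \<upsilon> k \<subseteq> (\<lambda>j :: int. real_of_int j / (real_of_int k * 2 powi \<upsilon>)) ` {0..<m}"
    by (auto simp: y_range_def m_def less_ceiling_iff)
  then have "card (y_range W \<upsilon> k) \<le> card {0..<m}"
    by (meson surj_card_le finite_atLeastLessThan_int)
  then have "real (card (y_range W \<upsilon> k)) \<le> real_of_int m" using m by simp
  then show ?thesis
    unfolding m_def by linarith
qed

text \<open>A crude bound that later absorbs the \<open>log W\<close> terms into a multiple of
  \<open>W\<close>.\<close>

lemma log2_nat_le: "log 2 (real n) \<le> real n"
proof (cases "n = 0")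
  case False
  have "real n \<le> 2 ^ n" by (rule less_imp_le, rule of_nat_less_two_power)
  then have "log 2 (real n) \<le> log 2 (2 ^ n)" using False by (intro log_mono) auto
  then show ?thesis by (simp add: log_pow_cancel)
qed (simp add: log_def)

text \<open>With \<open>N = 1 / (4 * W * e)\<close> one has \<open>W / e = 4 * W * W * N\<close>,
  and the number of remainders is at most \<open>8 * M + 1 \<le> 16 * M\<close> for
  \<open>M = W * W * W * N\<close>. Both bounds fit the form \<open>3 * log 2 W + L + 5\<close>, so
  one memory estimate covers both ways of counting the bits of \<open>y\<close>.\<close>

lemma y_bits_le:
  assumes "W \<ge> 1" "e > 0" "1 / (4 * real W * e) \<ge> 1"
  defines "L \<equiv> log 2 (1 / (4 * real W * e))"
  shows "real (nat (alg3_upsilon W e)) \<le> 3 * log 2 (real W) + L + 4"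
    "real (bits_for (card (y_range W (alg3_upsilon W e) k))) \<le> 3 * log 2 (real W) + L + 5"
proof -
  define N where "N = 1 / (4 * real W * e)"
  have N: "N \<ge> 1" "real W / e = 4 * (real W * real W) * N"
    using assms by (auto simp: N_def)
  have lW: "log 2 (real W) \<ge> 0" using assms by simp
  have "L = log 2 N" by (simp only: L_def N_def)
  moreover from this have "L \<ge> 0" using N by simp
  ultimately have L: "L \<ge> 0" "L = log 2 N" by auto
  have "log 2 4 = (2 :: real)" using log_pow_cancel[of 2 2] by simp
  then have "log 2 (real W / e) = 2 * log 2 (real W) + L + 2"
    using N assms(1) by (simp add: L log_mult_pos)
  then show "real (nat (alg3_upsilon W e)) \<le> 3 * log 2 (real W) + L + 4"
    using lW L unfolding alg3_upsilon_def by linarith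
  define M where "M = real W * real W * real W * N"
  have "1 * 1 * 1 * 1 \<le> M" unfolding M_def
    using assms(1) N(1) by (intro mult_mono) auto
  then have M: "M \<ge> 1" by simp
  have "real (card (y_range W (alg3_upsilon W e) k)) \<le> real W * (2 * (real W / e)) + 1"
    using card_y_range_le[of W "alg3_upsilon W e" k] upsilon_bounds(2)[OF assms(1,2)] assms(1)
    by (smt (verit) mult_left_mono of_nat_0_le_iff)
  also have "\<dots> = 8 * M + 1" by (simp add: N M_def)
  finally have "real (bits_for (card (y_range W (alg3_upsilon W e) k))) \<le> log 2 (16 * M) + 1"
    using M by (intro bits_for_le) linarith+
  moreover have "log 2 16 = (4 :: real)" using log_pow_cancel[of 2 4] by simp
  ultimately show "real (bits_for (card (y_range W (alg3_upsilon W e) k))) \<le> 3 * log 2 (real W) + L + 5"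
    using N assms(1) by (simp add: L M_def log_mult_pos)
qed

text \<open>The cells alone reach the budget, because \<open>k / W \<ge> 2 * N\<close> leaves each
  cell at least \<open>\<lfloor>N + 1\<rfloor>\<close> values. Conversely
  \<open>k / W \<le> 4 * N + 1\<close> keeps each cell within \<open>L + 5\<close> bits.\<close>

lemma memory_bounds:
  assumes "W \<ge> 1" "e > 0" "1 / (4 * real W * e) \<ge> 1"
  defines "L \<equiv> log 2 (1 / (4 * real W * e))"
  assumes q: "real q \<le> 3 * log 2 (real W) + L + 5"
  shows "summing_budget W e \<le> real (alg3_memory q W (alg3_k W e))"
    "real (alg3_memory q W (alg3_k W e)) \<le> real W * L + 2 * L + 21 * real W"
    "real W * L \<le> summing_budget W e"
proof -
  define N where "N = 1 / (4 * real W * e)"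
  have N: "N \<ge> 1" using assms by (simp add: N_def)
  have "L = log 2 N" by (simp only: L_def N_def)
  moreover from this have "L \<ge> 0" using N by simp
  ultimately have L: "L \<ge> 0" "L = log 2 N" by auto
  have W1: "real W \<ge> 1" using assms(1) by simp
  define k where "k = alg3_k W e"
  define f where "f = \<lfloor>1 + real_of_int k / real W\<rfloor>"
  \<comment> \<open>Here \<open>1 / (2 * e) = 2 * N * W\<close> and
    \<open>1 / e = 4 * N * W\<close>.\<close>
  have "2 * N * real W \<le> real_of_int k" "real_of_int k \<le> 4 * N * real W + 1"
    using k_bounds(2,3)[OF assms(1,2)] assms by (auto simp: k_def N_def)
  then have "2 * N \<le> real_of_int k / real W" "real_of_int k / real W \<le> 4 * N + 1 / real W"
    using W1 by (auto simp: field_simps)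
  moreover have "1 / real W \<le> 1" using W1 by simp
  ultimately have kW: "2 * N \<le> real_of_int k / real W" "real_of_int k / real W \<le> 4 * N + 1"
    by auto
  have f: "\<lfloor>N + 1\<rfloor> \<le> f" "real_of_int f \<le> 4 * N + 2" "f \<ge> 1"
    using kW N unfolding f_def by linarith+
  \<comment> \<open>As \<open>N \<ge> 1\<close> and \<open>W \<ge> 1\<close>, the additive terms are
    absorbed; 16 is a generous factor, chosen as a power of two so that its logarithm is 4.\<close>
  have "real (card (cell_range W k)) \<le> 16 * N"
    "real (card (B_range W k)) \<le> 16 * (real W * N)"
  proof -
    show "real (card (cell_range W k)) \<le> 16 * N"
      using f N by (simp add: cell_range_def flip: f_def)
    have "real W * real_of_int f \<le> real W * (4 * N + 2)" using f by (intro mult_left_mono) auto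
    moreover have "real W * 1 \<le> real W * N" using N by (intro mult_left_mono) auto
    moreover have "real (card (B_range W k)) = real W * real_of_int f + 1"
      using f unfolding B_range_def f_def[symmetric] by simp
    ultimately show "real (card (B_range W k)) \<le> 16 * (real W * N)"
      using W1 unfolding distrib_left by linarith
  qed
  moreover have "1 * 1 \<le> real W * N" using N W1 by (intro mult_mono) auto
  moreover have "log 2 16 = (4 :: real)" using log_pow_cancel[of 2 4] by simp
  ultimately have cell: "real (bits_for (card (cell_range W k))) \<le> L + 5"
    and B: "real (bits_for (card (B_range W k))) \<le> log 2 (real W) + L + 5"
    using bits_for_le[of "16 * N" "card (cell_range W k)"]
      bits_for_le[of "16 * (real W * N)" "card (B_range W k)"] N W1
    by (auto simp: log_mult_pos L)
  have idx: "real (bits_for (card (index_range W))) \<le> log 2 (real W) + 1"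
    using bits_for_bounds(2)[of W] assms(1) by (simp add: index_range_def)
  have mem: "real (alg3_memory q W k) = real q + real (bits_for (card (B_range W k)))
      + real (bits_for (card (index_range W))) + real W * real (bits_for (card (cell_range W k)))"
    by (simp add: alg3_memory_def)
  have lW: "log 2 (real W) \<le> real W" by (rule log2_nat_le)
  \<comment> \<open>Besides \<open>W * (L + 5)\<close> for the cells, the other variables take at
    most \<open>2 * L + 5 * log 2 W + 11\<close>; with \<open>log 2 W \<le> W\<close> and
    \<open>1 \<le> W\<close> the terms without \<open>L\<close> total
    \<open>(5 + 5 + 11) * W\<close>.\<close>
  have "real W * real (bits_for (card (cell_range W k))) \<le> real W * (L + 5)"
    using cell by (intro mult_left_mono) auto
  then show "real (alg3_memory q W (alg3_k W e)) \<le> real W * L + 2 * L + 21 * real W"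
    using q B idx lW W1 unfolding k_def[symmetric] mem by (simp add: algebra_simps)
  have N1: "real_of_int \<lfloor>N + 1\<rfloor> \<ge> N" by linarith
  then have "L \<le> log 2 (real_of_int \<lfloor>N + 1\<rfloor>)" using N unfolding L(2) by (intro log_mono) auto
  then show "real W * L \<le> summing_budget W e"
    unfolding summing_budget_def N_def[symmetric] by (intro mult_left_mono) auto
  have card: "real_of_int f \<le> real (card (cell_range W k))" "card (cell_range W k) \<ge> 1"
    using f by (auto simp: cell_range_def simp flip: f_def)
  then have "real_of_int \<lfloor>N + 1\<rfloor> \<le> real (card (cell_range W k))" using f(1) by linarith
  then have "log 2 (real_of_int \<lfloor>N + 1\<rfloor>) \<le> log 2 (real (card (cell_range W k)))"
    using N1 N by (intro log_mono) linarith+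
  also have "\<dots> \<le> real (bits_for (card (cell_range W k)))"
    using card(2) by (rule bits_for_bounds)
  finally have "summing_budget W e \<le> real W * real (bits_for (card (cell_range W k)))"
    unfolding summing_budget_def N_def[symmetric] by (intro mult_left_mono) auto
  then show "summing_budget W e \<le> real (alg3_memory q W (alg3_k W e))"
    unfolding k_def[symmetric] mem by linarith
qed

section \<open>Asymptotics for growing window size\<close>

text \<open>The smallness of \<epsilon> says that \<open>W * \<epsilon> W\<close> tends to 0;
  positivity turns this into divergence of the reciprocal to plus infinity.\<close>

lemma inverse_error_at_top:
  fixes \<epsilon> :: "nat \<Rightarrow> real"
  assumes pos: "\<And>W. W \<ge> 1 \<Longrightarrow> \<epsilon> W > 0"
    and small: "\<epsilon> \<in> o(\<lambda>W. 1 / real W)"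
  shows "filterlim (\<lambda>W. 1 / (4 * real W * \<epsilon> W)) at_top at_top"
proof -
  have "((\<lambda>W. 4 * (\<epsilon> W / (1 / real W))) \<longlongrightarrow> 4 * 0) at_top"
    by (intro tendsto_intros smalloD_tendsto[OF small])
  then have "((\<lambda>W. 4 * real W * \<epsilon> W) \<longlongrightarrow> 0) at_top"
    by (simp add: mult_ac)
  moreover have "\<forall>\<^sub>F W in at_top. 4 * real W * \<epsilon> W > 0"
    using eventually_ge_at_top[of 1] by eventually_elim (use pos in auto)
  ultimately have "filterlim (\<lambda>W. inverse (4 * real W * \<epsilon> W)) at_top at_top"
    by (rule filterlim_inverse_at_top)
  then show ?thesis by (simp only: inverse_eq_divide)
qed

text \<open>The relative excess \<delta> of the memory over the budget is squeezed between 0 and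
  \<open>2 / W + 21 / L\<close>, and both \<open>W\<close> and \<open>L\<close> tend to infinity.
  Keeping \<open>q\<close> abstract lets both accountings of \<open>y\<close> share the
  argument.\<close>

lemma memory_asymptotics:
  fixes \<epsilon> :: "nat \<Rightarrow> real" and q :: "nat \<Rightarrow> nat"
  assumes pos: "\<And>W. W \<ge> 1 \<Longrightarrow> \<epsilon> W > 0"
    and small: "\<epsilon> \<in> o(\<lambda>W. 1 / real W)"
    and q: "\<forall>\<^sub>F W in at_top. real (q W) \<le> 3 * log 2 (real W) + log 2 (1 / (4 * real W * \<epsilon> W)) + 5"
  shows "\<exists>\<delta> \<in> o(\<lambda>_. 1). \<forall>\<^sub>F W in at_top.
    real (alg3_memory (q W) W (alg3_k W (\<epsilon> W))) = summing_budget W (\<epsilon> W) * (1 + \<delta> W)"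
proof -
  define L where "L = (\<lambda>W. log 2 (1 / (4 * real W * \<epsilon> W)))"
  define mem where "mem = (\<lambda>W. real (alg3_memory (q W) W (alg3_k W (\<epsilon> W))))"
  define bud where "bud = (\<lambda>W. summing_budget W (\<epsilon> W))"
  define \<delta> where "\<delta> = (\<lambda>W. mem W / bud W - 1)"
  note N_at_top = inverse_error_at_top[OF pos small]
  have "filterlim (\<lambda>W. ln (1 / (4 * real W * \<epsilon> W)) * (1 / ln 2)) at_top at_top"
    by (rule filterlim_at_top_mult_tendsto_pos[OF tendsto_const _ filterlim_compose[OF ln_at_top N_at_top]]) simp
  then have L_at_top: "filterlim L at_top at_top"
    by (simp add: L_def log_def)
  have N_ge: "\<forall>\<^sub>F W in at_top. 1 / (4 * real W * \<epsilon> W) \<ge> 1"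
    using N_at_top by (auto simp: filterlim_at_top)
  have L_ge: "\<forall>\<^sub>F W in at_top. L W \<ge> 1"
    using L_at_top by (auto simp: filterlim_at_top)
  have bounds: "\<forall>\<^sub>F W in at_top. bud W > 0 \<and> 0 \<le> \<delta> W \<and> \<delta> W \<le> 2 / real W + 21 / L W"
    using N_ge L_ge q eventually_ge_at_top[of 1]
  proof eventually_elim
    case (elim W)
    note m = memory_bounds[OF elim(4) pos[OF elim(4)] elim(1,3)]
    have W: "real W \<ge> 1" using elim by simp
    have WL: "real W * L W > 0" using W elim(2) by (intro mult_pos_pos) auto
    have b: "real W * L W \<le> bud W" using m(3) by (simp add: bud_def L_def)
    have le: "mem W - bud W \<le> 2 * L W + 21 * real W"
      using m(2) b by (simp add: mem_def L_def)
    have ge: "bud W \<le> mem W" using m(1) by (simp add: mem_def bud_def)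
    have \<delta>: "\<delta> W = (mem W - bud W) / bud W" using WL b by (simp add: \<delta>_def diff_divide_distrib)
    \<comment> \<open>The budget is at least \<open>W * L\<close>, which bounds the numerator from
      above and the denominator from below.\<close>
    also have "\<dots> \<le> (2 * L W + 21 * real W) / (real W * L W)"
      using le ge b WL W elim(2) by (intro frac_le) auto
    also have "\<dots> = 2 / real W + 21 / L W"
      using W elim(2) by (simp add: field_simps)
    finally show ?case
      using ge b WL \<delta> by auto
  qed
  have "((\<lambda>W. 2 / real W + 21 / L W) \<longlongrightarrow> 0 + 0) at_top"
    by (intro tendsto_add real_tendsto_divide_at_top[OF tendsto_const] filterlim_real_sequentially L_at_top)
  then have "(\<delta> \<longlongrightarrow> 0) at_top"
    by (intro tendsto_sandwich[OF _ _ tendsto_const, of _ \<delta>]) (use bounds in \<open>auto elim: eventually_mono\<close>)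
  then have "\<delta> \<in> o(\<lambda>_. 1)"
    by (intro smalloI_tendsto) auto
  \<comment> \<open>The budget can vanish for small \<open>W\<close>; once it is positive, the
    definition of \<delta> can be solved for the memory.\<close>
  moreover have "\<forall>\<^sub>F W in at_top. mem W = bud W * (1 + \<delta> W)"
    using bounds by eventually_elim (auto simp: \<delta>_def)
  ultimately show ?thesis by (auto simp: mem_def bud_def)
qed

text \<open>The exact remainder moves on a grid finer than \<open>2 powi (- \<upsilon>)\<close> when
  \<open>k > 1\<close>, so the memory bound is given for \<upsilon> bits and also for enough bits to
  store every element of \<open>y_range\<close>. The inclusion of the reachable states justifies the
  sizes allotted to the variables.\<close>

theorem theorem19:
  fixes \<epsilon> :: "nat \<Rightarrow> real"
    and \<upsilon> k :: "nat \<Rightarrow> int"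
  defines "\<upsilon> \<equiv> \<lambda>W. alg3_upsilon W (\<epsilon> W)"
    and "k \<equiv> \<lambda>W. alg3_k W (\<epsilon> W)"
  assumes pos: "\<And>W. W \<ge> 1 \<Longrightarrow> \<epsilon> W > 0"
    and small: "\<epsilon> \<in> o(\<lambda>W. 1 / real W)"
  shows "(\<forall>W\<ge>1. \<forall>R\<ge>1.
            additive_approx_summing W R (real R * real W * \<epsilon> W)
              (alg3_init W) (alg3_add W R (\<upsilon> W) (k W)) (alg3_query W R (k W)))
       \<and> (\<exists>\<delta> \<in> o(\<lambda>_. 1). \<forall>\<^sub>F W in at_top.
            real (alg3_memory (nat (\<upsilon> W)) W (k W))
              = summing_budget W (\<epsilon> W) * (1 + \<delta> W))
       \<and> (\<forall>\<^sub>F W in at_top. \<forall>R\<ge>1.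
            alg3_reachable W R (\<upsilon> W) (k W) \<subseteq> alg3_state_range W (\<upsilon> W) (k W))
       \<and> (\<exists>\<delta> \<in> o(\<lambda>_. 1). \<forall>\<^sub>F W in at_top.
            real (alg3_memory (bits_for (card (y_range W (\<upsilon> W) (k W)))) W (k W))
              = summing_budget W (\<epsilon> W) * (1 + \<delta> W))"
proof (intro conjI)
  have k1: "k W \<ge> 1" if "W \<ge> 1" for W
    unfolding k_def using k_bounds(4) pos that by blast
  have error: "real W / 2 * (2 powi (- \<upsilon> W) + 1 / real_of_int (k W)) \<le> real W * \<epsilon> W"
    if "W \<ge> 1" for W
  proof -
    have "real W / 2 * (2 powi (- \<upsilon> W) + 1 / real_of_int (k W)) \<le> real W / 2 * (2 * \<epsilon> W)"
      unfolding k_def \<upsilon>_def using k_bounds(1)[OF that pos[OF that]] by (intro mult_left_mono) auto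
    then show ?thesis by simp
  qed
  show "\<forall>W\<ge>1. \<forall>R\<ge>1. additive_approx_summing W R (real R * real W * \<epsilon> W)
              (alg3_init W) (alg3_add W R (\<upsilon> W) (k W)) (alg3_query W R (k W))"
    unfolding additive_approx_summing_def
  proof (intro allI impI ballI)
    fix W R :: nat and xs
    assume "W \<ge> 1" "R \<ge> 1"
    then have "\<bar>alg3_query W R (k W) (foldl (alg3_add W R (\<upsilon> W) (k W)) (alg3_init W) xs) - real (window_sum W xs)\<bar>
      \<le> real R * (real W / 2 * (2 powi (- \<upsilon> W) + 1 / real_of_int (k W)))"
      using k1 by (intro alg3_error) auto
    also have "\<dots> \<le> real R * (real W * \<epsilon> W)"
      using error[OF \<open>W \<ge> 1\<close>] by (intro mult_left_mono) auto
    finally show "\<bar>alg3_query W R (k W) (foldl (alg3_add W R (\<upsilon> W) (k W)) (alg3_init W) xs) - real (window_sum W xs)\<bar>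
      \<le> real R * real W * \<epsilon> W" by (simp add: mult.assoc)
  qed
  have N_ge: "\<forall>\<^sub>F W in at_top. 1 / (4 * real W * \<epsilon> W) \<ge> 1"
    using inverse_error_at_top[OF pos small] by (auto simp: filterlim_at_top)
  show "\<exists>\<delta> \<in> o(\<lambda>_. 1). \<forall>\<^sub>F W in at_top.
          real (alg3_memory (nat (\<upsilon> W)) W (k W)) = summing_budget W (\<epsilon> W) * (1 + \<delta> W)"
    unfolding k_def
  proof (rule memory_asymptotics[OF pos small])
    show "\<forall>\<^sub>F W in at_top. real (nat (\<upsilon> W))
            \<le> 3 * log 2 (real W) + log 2 (1 / (4 * real W * \<epsilon> W)) + 5"
      using N_ge eventually_ge_at_top[of 1]
      by eventually_elim (use y_bits_le(1) pos in \<open>fastforce simp: \<upsilon>_def\<close>)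
  qed
  show "\<exists>\<delta> \<in> o(\<lambda>_. 1). \<forall>\<^sub>F W in at_top.
          real (alg3_memory (bits_for (card (y_range W (\<upsilon> W) (k W)))) W (k W))
            = summing_budget W (\<epsilon> W) * (1 + \<delta> W)"
    unfolding k_def
  proof (rule memory_asymptotics[OF pos small])
    show "\<forall>\<^sub>F W in at_top. real (bits_for (card (y_range W (\<upsilon> W) (alg3_k W (\<epsilon> W)))))
            \<le> 3 * log 2 (real W) + log 2 (1 / (4 * real W * \<epsilon> W)) + 5"
      using N_ge eventually_ge_at_top[of 1]
      by eventually_elim (use y_bits_le(2) pos in \<open>auto simp: \<upsilon>_def\<close>)
  qed
  show "\<forall>\<^sub>F W in at_top. \<forall>R\<ge>1. alg3_reachable W R (\<upsilon> W) (k W) \<subseteq> alg3_state_range W (\<upsilon> W) (k W)"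
    using N_ge eventually_ge_at_top[of 1]
  proof eventually_elim
    case (elim W)
    have W: "real W \<ge> 1" and e: "\<epsilon> W > 0" using elim(2) pos by auto
    \<comment> \<open>Integrality of the grid needs \<open>\<upsilon> \<ge> 0\<close>, that is, it
      suffices that \<open>\<epsilon> W \<le> W\<close>; this follows from
      \<open>\<epsilon> W \<le> W * \<epsilon> W \<le> 1 / 4\<close>.\<close>
    have "4 * real W * \<epsilon> W \<le> 1" using elim(1) W e by (simp add: field_simps)
    moreover have "1 * \<epsilon> W \<le> real W * \<epsilon> W" using W e by (intro mult_right_mono) auto
    ultimately have "\<epsilon> W \<le> real W" using W by linarith
    then have "log 2 (real W / \<epsilon> W) \<ge> 0" using e W by simp
    then have "\<upsilon> W \<ge> 0" unfolding \<upsilon>_def alg3_upsilon_def by linarith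
    then show ?case
      using reachable_subset_state_range k1 elim(2) by blast
  qed
qed

end
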